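(* Let $G=\{(z+w,zw):|z|<1,\ |w|<1\}\subset\mathbb{C}^2$ be the symmetrised bidisc. For $m\in\mathrm{Aut}\,\mathbb{D}$ let $\tau(m)\in\mathrm{Aut}\,G$ be the automorphism given by $$\tau(m)(z_1+z_2,z_1z_2)=(m(z_1)+m(z_2),\,m(z_1)m(z_2)),\qquad z_1,z_2\in\mathbb{D}.$$ Then $\tau:\mathrm{Aut}\,\mathbb{D}\to\mathrm{Aut}\,G$ is an isomorphism of groups.
   Context: $\mathbb{D}$ is the open unit disc in $\mathbb{C}$. An automorphism of a domain $\Omega$ in $\mathbb{C}^d$ is an analytic bijective self-map of $\Omega$ having an analytic inverse; $\mathrm{Aut}\,\Omega$ denotes the group of automorphisms of $\Omega$ under composition. *)

theory Defs
  imports "HOL-Analysis.Analysis" "HOL-Algebra.Bij"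
begin

text \<open>
  Analyticity of maps between complex coordinate spaces, patterned on the library's
  one-variable notion (\<^const>\<open>analytic_on\<close>): near every point of the set the map is
  Frechet differentiable with a complex-linear (not merely real-linear) derivative.
\<close>

definition analytic_map_on ::
    "(complex ^ 'n \<Rightarrow> complex ^ 'm) \<Rightarrow> (complex ^ 'n) set \<Rightarrow> bool"
    (infixl \<open>analytic'_map'_on\<close> 50) where
  "f analytic_map_on S \<longleftrightarrow>
     (\<forall>x\<in>S. \<exists>e>0. \<forall>y\<in>ball x e.
        \<exists>f'. (f has_derivative f') (at y) \<and> Vector_Spaces.linear (*s) (*s) f')"

text \<open>
  The predicate \<open>analytic f S\<close> is the notion of analyticity appropriate to the ambient space.
  As in \<^const>\<open>Bij\<close>, self-maps of \<open>S\<close> are represented by total functions that are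
  \<^const>\<open>undefined\<close> off \<open>S\<close>, so that equality of functions is equality of self-maps; for open
  \<open>S\<close> the values off \<open>S\<close> do not affect analyticity. Multiplication is inherited from
  \<^const>\<open>BijGroup\<close>, i.e. the product of \<open>g\<close> and \<open>f\<close> is \<open>g\<close> after \<open>f\<close>.
\<close>

definition aut_group :: "(('a \<Rightarrow> 'a) \<Rightarrow> 'a set \<Rightarrow> bool) \<Rightarrow> 'a set \<Rightarrow> ('a \<Rightarrow> 'a) monoid" where
  "aut_group analytic S =
     (BijGroup S)\<lparr>carrier := {f \<in> Bij S. analytic f S \<and> analytic (inv_into S f) S}\<rparr>"

definition disc :: "complex set" where
  "disc = {z. norm z < 1}"

definition symmetrization :: "complex \<Rightarrow> complex \<Rightarrow> complex ^ 2" where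
  "symmetrization z w = vector [z + w, z * w]"

definition sym_bidisc :: "(complex ^ 2) set" where
  "sym_bidisc = {symmetrization z w | z w. norm z < 1 \<and> norm w < 1}"

definition Aut_disc :: "(complex \<Rightarrow> complex) monoid" where
  "Aut_disc = aut_group (analytic_on) disc"

definition Aut_sym_bidisc :: "(complex ^ 2 \<Rightarrow> complex ^ 2) monoid" where
  "Aut_sym_bidisc = aut_group (analytic_map_on) sym_bidisc"

text \<open>
  A point of the symmetrised bidisc determines its preimage \<open>(z, w)\<close> only up to order; the
  image point below does not depend on the order, hence the definite description.
\<close>

definition tau :: "(complex \<Rightarrow> complex) \<Rightarrow> complex ^ 2 \<Rightarrow> complex ^ 2" where
  "tau m = (\<lambda>p\<in>sym_bidisc. THE q. \<exists>z\<in>disc. \<exists>w\<in>disc.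
              p = symmetrization z w \<and> q = symmetrization (m z) (m w))"

end

theory Submission
  imports Defs "HOL-Complex_Analysis.Riemann_Mapping"
begin

text \<open>
  A point \<open>(s, p) = (z + w, z w)\<close> of the symmetrised bidisc \<open>G\<close> is the same thing as an unordered pair of
  points of the disc, namely the roots of \<open>X\<^sup>2 - s X + p\<close>, and \<open>tau m\<close> applies \<open>m\<close> to both members of
  the pair. Multiplicativity and injectivity of \<open>tau\<close> are immediate from this. Two things need
  analysis.

  First, \<open>tau m\<close> is analytic: automorphisms of the disc are Moebius maps
  (\<open>disc_automorphism_Moebius\<close>), and for these the symmetric functions of \<open>m z\<close> and \<open>m w\<close> are
  quotients of affine functions of \<open>(s, p)\<close> (\<open>tau_Moebius_analytic\<close>).

  Second, every automorphism \<open>F\<close> of \<open>G\<close> is of the form \<open>tau m\<close>. The boundary of \<open>G\<close> consists of points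
  with a root on the unit circle, and on an analytic disc inside the boundary this root can be
  chosen constant, by the maximum principle applied to \<open>(s - 2 p) / (2 - s)\<close>
  (\<open>boundary_disc_common_root\<close>). Fix \<open>w1\<close> and \<open>w2\<close> and let \<open>z\<close> tend to the circle. As \<open>F\<close> is proper, the
  maps \<open>w \<mapsto> F (z + w, z w)\<close> accumulate at analytic discs in the boundary, so the resultant of the
  quadratics belonging to \<open>F (z + w1, z w1)\<close> and \<open>F (z + w2, z w2)\<close> tends to \<open>0\<close>. It is holomorphic in \<open>z\<close>,
  hence it vanishes identically (\<open>analytic_proper_map_preserves_shared_root\<close>).

  Thus \<open>F\<close>, and likewise its inverse, sends pairs with a common point to pairs with a common point.
  The rest is combinatorics: a bijection of unordered pairs with this property is induced by a
  bijection \<open>m\<close> of the underlying points (\<open>pair_bijection_induced\<close>). Since \<open>F (2 z, z\<^sup>2)\<close> has first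
  coordinate \<open>2 m z\<close>, the map \<open>m\<close> is holomorphic, and so is its inverse for the same reason.
\<close>

section \<open>Automorphism groups\<close>

text \<open>
  Elements of \<open>Bij S\<close> are \<open>undefined\<close> off \<open>S\<close>, so products and inverses in the group agree only
  on \<open>S\<close> with the composites and inverse functions whose analyticity is known. This is why
  analyticity is required to depend on the values on \<open>S\<close> alone.
\<close>

lemma group_aut_group:
  assumes cong: "\<And>f g. analytic f S \<Longrightarrow> (\<And>x. x \<in> S \<Longrightarrow> f x = g x) \<Longrightarrow> analytic g S"
    and comp: "\<And>f g. analytic f S \<Longrightarrow> analytic g S \<Longrightarrow> f ` S \<subseteq> S \<Longrightarrow> analytic (g \<circ> f) S"
    and id: "analytic (\<lambda>x. x) S"
  shows "group (aut_group analytic S)"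
proof -
  let ?A = "{f \<in> Bij S. analytic f S \<and> analytic (inv_into S f) S}"
  have img: "f ` S = S" "inj_on f S" "inv_into S f ` S = S" if "f \<in> Bij S" for f
    using that bij_betw_inv_into[of f S S] by (auto simp: Bij_def bij_betw_def)
  have "subgroup ?A (BijGroup S)"
  proof (rule subgroup.intro)
    show "?A \<subseteq> carrier (BijGroup S)"
      by (auto simp: BijGroup_def)
    show "\<one>\<^bsub>BijGroup S\<^esub> \<in> ?A"
    proof -
      have "inv_into S (\<lambda>x\<in>S. x) x = x" if "x \<in> S" for x
        using that by (intro inv_into_f_eq) (auto simp: inj_on_def)
      then show ?thesis
        using cong[OF id, of "\<lambda>x\<in>S. x"] cong[OF id, of "inv_into S (\<lambda>x\<in>S. x)"]
        by (auto simp: BijGroup_def id_Bij)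
    qed
  next
    fix g f assume g: "g \<in> ?A" and f: "f \<in> ?A"
    have "inv_into S (compose S g f) x = (inv_into S f \<circ> inv_into S g) x" if "x \<in> S" for x
    proof (rule inv_into_f_eq)
      show "inj_on (compose S g f) S"
        using g f compose_Bij[of g S f] img by blast
      have "inv_into S g x \<in> S" "g (inv_into S g x) = x"
        using g that by (simp_all add: img inv_into_into f_inv_into_f)
      moreover from this f have "inv_into S f (inv_into S g x) \<in> S"
        "f (inv_into S f (inv_into S g x)) = inv_into S g x"
        by (simp_all add: img inv_into_into f_inv_into_f)
      ultimately show "(inv_into S f \<circ> inv_into S g) x \<in> S"
        "compose S g f ((inv_into S f \<circ> inv_into S g) x) = x"
        by (simp_all add: compose_def)
    qed
    moreover have "analytic (inv_into S f \<circ> inv_into S g) S" "analytic (g \<circ> f) S"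
      using comp f g img by auto
    ultimately have "analytic (inv_into S (compose S g f)) S" "analytic (compose S g f) S"
      using cong[of "inv_into S f \<circ> inv_into S g" "inv_into S (compose S g f)"]
        cong[of "g \<circ> f" "compose S g f"] by (auto simp: compose_def)
    then show "g \<otimes>\<^bsub>BijGroup S\<^esub> f \<in> ?A"
      using f g by (simp add: BijGroup_def compose_Bij)
  next
    fix f assume f: "f \<in> ?A"
    have "inv_into S (restrict (inv_into S f) S) x = f x" if "x \<in> S" for x
    proof (rule inv_into_f_eq)
      show "inj_on (restrict (inv_into S f) S) S"
        using f restrict_inv_into_Bij[of f S] img by blast
    qed (use f img that in auto)
    then show "inv\<^bsub>BijGroup S\<^esub> f \<in> ?A"
      using f cong[of "inv_into S f" "restrict (inv_into S f) S"]
        cong[of f "inv_into S (restrict (inv_into S f) S)"]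
      by (auto simp: inv_BijGroup restrict_inv_into_Bij)
  qed
  then show ?thesis
    unfolding aut_group_def by (rule subgroup.subgroup_is_group) (rule group_BijGroup)
qed

section \<open>Bijections of unordered pairs\<close>

text \<open>
  A pairwise intersecting family of sets with at most two elements either has a common point or
  lies inside a triangle \<open>{a, b}\<close>, \<open>{b, c}\<close>, \<open>{a, c}\<close>, and a triangle has only finitely many subsets.
\<close>

lemma infinite_intersecting_pairs_common_point:
  assumes inf: "infinite \<F>"
    and pairs: "\<And>A. A \<in> \<F> \<Longrightarrow> \<exists>a b. A = {a, b}"
    and meet: "\<And>A B. A \<in> \<F> \<Longrightarrow> B \<in> \<F> \<Longrightarrow> A \<inter> B \<noteq> {}"
  shows "\<exists>x. \<forall>A\<in>\<F>. x \<in> A"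
proof (rule ccontr)
  assume "\<not> ?thesis"
  then have none: "\<exists>A\<in>\<F>. x \<notin> A" for x
    by blast
  obtain A a b where A: "A \<in> \<F>" "A = {a, b}"
    using none pairs by meson
  obtain B where B: "B \<in> \<F>" "a \<notin> B"
    using none by blast
  obtain C where C: "C \<in> \<F>" "b \<notin> C"
    using none by blast
  have "b \<in> B" "a \<in> C"
    using meet[OF A(1) B(1)] meet[OF A(1) C(1)] A B C by auto
  obtain c where B': "B = {b, c}"
    using pairs[OF B(1)] \<open>b \<in> B\<close> by (metis insert_commute insertE singletonD)
  obtain d where C': "C = {a, d}"
    using pairs[OF C(1)] \<open>a \<in> C\<close> by (metis insert_commute insertE singletonD)
  \<comment> \<open>Now \<open>A\<close>, \<open>B\<close>, \<open>C\<close> are the three sides of a triangle, and a pair that meets all three sides is itself contained in the triangle.\<close>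
  have "d = c"
    using meet[OF B(1) C(1)] B C B' C' by auto
  have "X \<subseteq> {a, b, c}" if X: "X \<in> \<F>" for X
  proof -
    obtain x y where "X = {x, y}"
      using pairs[OF X] by blast
    then show ?thesis
      using meet[OF X A(1)] meet[OF X B(1)] meet[OF X C(1)] A B C B' C' \<open>d = c\<close> by auto
  qed
  then have "\<F> \<subseteq> Pow {a, b, c}"
    by blast
  then show False
    using inf finite_subset by blast
qed

text \<open>
  The pairs through a fixed \<open>z\<close> form an infinite intersecting family, and so do their images; the
  common point of the images is \<open>m z\<close>. Doing the same for the inverse \<open>\<Psi>\<close> gives a map \<open>n\<close>, which turns
  out to be inverse to \<open>m\<close>. For \<open>z \<noteq> w\<close> the image of \<open>{z, w}\<close> contains the two distinct points \<open>m z\<close> and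
  \<open>m w\<close>; the images of the singletons are then forced by injectivity of \<open>\<Phi>\<close>.
\<close>

lemma pair_bijection_induced:
  fixes D :: "'a set"
  defines "P \<equiv> {{a, b} |a b. a \<in> D \<and> b \<in> D}"
  assumes inf: "infinite D"
    and \<Phi>: "\<And>A. A \<in> P \<Longrightarrow> \<Phi> A \<in> P" "\<And>A. A \<in> P \<Longrightarrow> \<Psi> (\<Phi> A) = A"
    and \<Psi>: "\<And>A. A \<in> P \<Longrightarrow> \<Psi> A \<in> P" "\<And>A. A \<in> P \<Longrightarrow> \<Phi> (\<Psi> A) = A"
    and meet\<Phi>: "\<And>A B. A \<in> P \<Longrightarrow> B \<in> P \<Longrightarrow> A \<inter> B \<noteq> {} \<Longrightarrow> \<Phi> A \<inter> \<Phi> B \<noteq> {}"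
    and meet\<Psi>: "\<And>A B. A \<in> P \<Longrightarrow> B \<in> P \<Longrightarrow> A \<inter> B \<noteq> {} \<Longrightarrow> \<Psi> A \<inter> \<Psi> B \<noteq> {}"
  shows "\<exists>m. bij_betw m D D \<and> (\<forall>z\<in>D. \<forall>w\<in>D. \<Phi> {z, w} = {m z, m w})"
proof -
  have other: "\<exists>u\<in>D. A = {x, u}" if A: "A \<in> P" and x: "x \<in> A" for A x
  proof -
    obtain a b where "A = {a, b}" "a \<in> D" "b \<in> D"
      using A unfolding P_def by blast
    with x show ?thesis
      by (metis insertE insert_commute singletonD)
  qed
  have star: "\<exists>x\<in>D. \<forall>w\<in>D. x \<in> \<Theta> {z, w}"
    if "z \<in> D" and \<Theta>: "\<And>A. A \<in> P \<Longrightarrow> \<Theta> A \<in> P" "inj_on \<Theta> P"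
      "\<And>A B. A \<in> P \<Longrightarrow> B \<in> P \<Longrightarrow> A \<inter> B \<noteq> {} \<Longrightarrow> \<Theta> A \<inter> \<Theta> B \<noteq> {}" for \<Theta> z
  proof -
    let ?\<F> = "(\<lambda>w. \<Theta> {z, w}) ` D"
    have P: "{z, w} \<in> P" if "w \<in> D" for w
      using that \<open>z \<in> D\<close> by (auto simp: P_def)
    have "inj_on (\<lambda>w. \<Theta> {z, w}) D"
    proof (rule inj_onI)
      fix u v assume "u \<in> D" "v \<in> D" "\<Theta> {z, u} = \<Theta> {z, v}"
      then have "{z, u} = {z, v}"
        using inj_onD[OF \<Theta>(2)] P by blast
      then show "u = v"
        by (auto simp: doubleton_eq_iff)
    qed
    then have "infinite ?\<F>"
      using inf finite_imageD by blast
    moreover have "\<exists>a b. A = {a, b}" if A: "A \<in> ?\<F>" for A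
    proof -
      have "A \<in> P"
        using A \<Theta>(1) P by auto
      then show ?thesis
        unfolding P_def by blast
    qed
    moreover have "A \<inter> B \<noteq> {}" if AB: "A \<in> ?\<F>" "B \<in> ?\<F>" for A B
    proof -
      obtain u v where "A = \<Theta> {z, u}" "B = \<Theta> {z, v}" "u \<in> D" "v \<in> D"
        using AB by blast
      then show ?thesis
        using \<Theta>(3)[OF P P, of u v] by simp
    qed
    ultimately have "\<exists>x. \<forall>A\<in>?\<F>. x \<in> A"
      by (rule infinite_intersecting_pairs_common_point)
    then obtain x where x: "\<forall>w\<in>D. x \<in> \<Theta> {z, w}"
      by blast
    moreover have "\<Theta> {z, z} \<subseteq> D"
      using \<Theta>(1)[OF P[OF \<open>z \<in> D\<close>]] by (auto simp: P_def)
    ultimately show ?thesis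
      using \<open>z \<in> D\<close> by blast
  qed
  have inj: "inj_on \<Phi> P" "inj_on \<Psi> P"
    by (rule inj_on_inverseI, erule \<Phi>(2), rule inj_on_inverseI, erule \<Psi>(2))
  obtain m where m: "\<And>z. z \<in> D \<Longrightarrow> m z \<in> D" "\<And>z w. z \<in> D \<Longrightarrow> w \<in> D \<Longrightarrow> m z \<in> \<Phi> {z, w}"
  proof -
    have "\<exists>x\<in>D. \<forall>w\<in>D. x \<in> \<Phi> {z, w}" if "z \<in> D" for z
      by (rule star[where \<Theta> = \<Phi>]; fact that \<Phi>(1) inj(1) meet\<Phi>)
    then show thesis
      using that by metis
  qed
  obtain n where n: "\<And>z. z \<in> D \<Longrightarrow> n z \<in> D" "\<And>z w. z \<in> D \<Longrightarrow> w \<in> D \<Longrightarrow> n z \<in> \<Psi> {z, w}"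
  proof -
    have "\<exists>x\<in>D. \<forall>w\<in>D. x \<in> \<Psi> {z, w}" if "z \<in> D" for z
      by (rule star[where \<Theta> = \<Psi>]; fact that \<Psi>(1) inj(2) meet\<Psi>)
    then show thesis
      using that by metis
  qed
  have zz: "{z, z} \<in> P" if "z \<in> D" for z
    using that by (auto simp: P_def)
  have nm: "n (m z) = z" if z: "z \<in> D" for z
  proof -
    obtain u where "\<Phi> {z, z} = {m z, u}" "u \<in> D"
      using other[OF \<Phi>(1)[OF zz[OF z]] m(2)[OF z z]] by blast
    then have "n (m z) \<in> {z, z}"
      using n(2)[of "m z" u] m(1) z \<Phi>(2)[OF zz[OF z]] by simp
    then show ?thesis
      by simp
  qed
  have mn: "m (n z) = z" if z: "z \<in> D" for z
  proof -
    obtain u where "\<Psi> {z, z} = {n z, u}" "u \<in> D"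
      using other[OF \<Psi>(1)[OF zz[OF z]] n(2)[OF z z]] by blast
    then have "m (n z) \<in> {z, z}"
      using m(2)[of "n z" u] n(1) z \<Psi>(2)[OF zz[OF z]] by simp
    then show ?thesis
      by simp
  qed
  have bij: "bij_betw m D D"
    by (rule bij_betwI[of _ _ _ n]) (use m n nm mn in auto)
  have off: "\<Phi> {z, w} = {m z, m w}" if "z \<in> D" "w \<in> D" "z \<noteq> w" for z w
  proof -
    have "m z \<noteq> m w"
      using that nm by metis
    moreover have "m z \<in> \<Phi> {z, w}" "m w \<in> \<Phi> {z, w}"
      using m(2)[of z w] m(2)[of w z] that by (simp_all add: insert_commute)
    moreover have "\<Phi> {z, w} \<in> P"
      using \<Phi>(1) that unfolding P_def by blast
    ultimately show ?thesis
      by (auto simp: P_def)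
  qed
  \<comment> \<open>The image of a singleton contains \<open>m z\<close>; a second point \<open>u\<close> would make it the image of the pair \<open>{z, n u}\<close> as well.\<close>
  have diag: "\<Phi> {z, z} = {m z, m z}" if z: "z \<in> D" for z
  proof -
    obtain u where u: "\<Phi> {z, z} = {m z, u}" "u \<in> D"
      using other[OF \<Phi>(1)[OF zz[OF z]] m(2)[OF z z]] by blast
    have "n u = z"
    proof (rule ccontr)
      assume "n u \<noteq> z"
      then have "\<Phi> {z, n u} = \<Phi> {z, z}"
        using off[of z "n u"] n(1) mn u z by simp
      moreover have "{z, n u} \<in> P"
        using n(1) u(2) z by (auto simp: P_def)
      ultimately have "{z, n u} = {z, z}"
        using inj(1) zz[OF z] by (meson inj_onD)
      then show False
        using \<open>n u \<noteq> z\<close> by (auto simp: doubleton_eq_iff)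
    qed
    then have "u = m z"
      using mn[OF u(2)] by simp
    with u(1) show ?thesis
      by simp
  qed
  show ?thesis
    using bij off diag by blast
qed

section \<open>Geometry of the symmetrised bidisc\<close>

lemma symmetrization_nth [simp]:
  "symmetrization z w $ 1 = z + w" "symmetrization z w $ 2 = z * w"
  by (simp_all add: symmetrization_def)

lemma mem_disc [simp]: "z \<in> disc \<longleftrightarrow> norm z < 1"
  by (simp add: disc_def)

lemma disc_eq_ball: "disc = ball 0 1"
  by auto

lemma symmetrization_mem [simp]: "norm z < 1 \<Longrightarrow> norm w < 1 \<Longrightarrow> symmetrization z w \<in> sym_bidisc"
  by (auto simp: sym_bidisc_def)

lemma sym_bidiscE:
  assumes "q \<in> sym_bidisc"
  obtains z w where "norm z < 1" "norm w < 1" "q = symmetrization z w"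
  using assms by (auto simp: sym_bidisc_def)

lemma symmetrization_commute: "symmetrization z w = symmetrization w z"
  by (simp add: symmetrization_def add.commute mult.commute)

text \<open>
  The coordinates \<open>(s, p)\<close> are the elementary symmetric functions, so the roots of \<open>X\<^sup>2 - s X + p\<close> are the
  unordered pair of which \<open>(s, p)\<close> is the symmetrization.
\<close>

definition roots :: "complex ^ 2 \<Rightarrow> complex set" where
  "roots q = {x. x\<^sup>2 - q $ 1 * x + q $ 2 = 0}"

lemma roots_symmetrization [simp]: "roots (symmetrization z w) = {z, w}"
proof -
  have "x\<^sup>2 - (z + w) * x + z * w = (x - z) * (x - w)" for x
    by (simp add: algebra_simps power2_eq_square)
  then show ?thesis
    by (auto simp: roots_def)
qed

lemma vec2_eq_iff: "(q :: 'a ^ 2) = q' \<longleftrightarrow> q $ 1 = q' $ 1 \<and> q $ 2 = q' $ 2"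
  by (simp add: vec_eq_iff forall_2)

lemma symmetrization_eq_iff:
  "symmetrization z w = symmetrization z' w' \<longleftrightarrow> {z, w} = {z', w'}"
  by (metis roots_symmetrization doubleton_eq_iff symmetrization_commute)

lemma symmetrization_surj: obtains z w where "q = symmetrization z w"
proof -
  define d where "d = csqrt ((q $ 1)\<^sup>2 - 4 * q $ 2)"
  have "d\<^sup>2 = (q $ 1)\<^sup>2 - 4 * q $ 2"
    by (simp add: d_def)
  then have "q = symmetrization ((q $ 1 + d) / 2) ((q $ 1 - d) / 2)"
    by (simp add: vec2_eq_iff field_simps power2_eq_square)
  then show ?thesis
    by (rule that)
qed

lemma symmetrization_mem_iff: "symmetrization z w \<in> sym_bidisc \<longleftrightarrow> norm z < 1 \<and> norm w < 1"
  by (auto simp: sym_bidisc_def symmetrization_eq_iff doubleton_eq_iff)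

lemma bij_betw_roots:
  "bij_betw roots sym_bidisc {{a, b} |a b. a \<in> disc \<and> b \<in> disc}"
proof (rule bij_betw_imageI)
  show "inj_on roots sym_bidisc"
    by (auto simp: inj_on_def sym_bidisc_def symmetrization_eq_iff)
  show "roots ` sym_bidisc = {{a, b} |a b. a \<in> disc \<and> b \<in> disc}"
  proof (intro equalityI subsetI)
    fix A assume "A \<in> {{a, b} |a b. a \<in> disc \<and> b \<in> disc}"
    then obtain a b where "A = roots (symmetrization a b)" "norm a < 1" "norm b < 1"
      by auto
    then show "A \<in> roots ` sym_bidisc"
      by (blast intro: symmetrization_mem)
  next
    fix A assume "A \<in> roots ` sym_bidisc"
    then obtain z w where "norm z < 1" "norm w < 1" "A = {z, w}"
      by (auto elim!: sym_bidiscE)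
    then show "A \<in> {{a, b} |a b. a \<in> disc \<and> b \<in> disc}"
      unfolding mem_disc by blast
  qed
qed

text \<open>
  This is the resultant of the quadratics \<open>X\<^sup>2 - s X + p\<close> with coefficients \<open>q\<close> and \<open>q'\<close>. Being polynomial
  in the coefficients, it turns the set-theoretic condition of sharing a root into a
  holomorphic equation.
\<close>

definition resultant :: "complex ^ 2 \<Rightarrow> complex ^ 2 \<Rightarrow> complex" where
  "resultant q q' = (q $ 1 - q' $ 1) * (q $ 1 * q' $ 2 - q' $ 1 * q $ 2) + (q $ 2 - q' $ 2)\<^sup>2"

lemma resultant_symmetrization:
  "resultant (symmetrization a b) (symmetrization c d) = (a - c) * (a - d) * (b - c) * (b - d)"
  by (simp add: resultant_def algebra_simps power2_eq_square)

lemma resultant_eq_0_iff: "resultant q q' = 0 \<longleftrightarrow> roots q \<inter> roots q' \<noteq> {}"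
proof -
  obtain a b c d where "q = symmetrization a b" "q' = symmetrization c d"
    by (metis symmetrization_surj)
  then show ?thesis
    by (auto simp: resultant_symmetrization)
qed

text \<open>
  With \<open>s = z + w\<close> and \<open>p = z w\<close>, the point is the identity
  \<open>s - cnj s p = z (1 - \<bar>w\<bar>\<^sup>2) + w (1 - \<bar>z\<bar>\<^sup>2)\<close>.
\<close>

lemma norm_symmetric_combination_le:
  fixes z w :: complex
  shows "norm z \<le> 1 \<Longrightarrow> norm w \<le> 1 \<Longrightarrow>
    norm (z + w - cnj (z + w) * (z * w)) \<le> (norm z + norm w) * (1 - norm z * norm w)"
proof -
  assume zw: "norm z \<le> 1" "norm w \<le> 1"
  have eq: "z + w - cnj (z + w) * (z * w) = z * of_real (1 - (norm w)\<^sup>2) + w * of_real (1 - (norm z)\<^sup>2)"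
    by (simp add: algebra_simps complex_norm_square flip: of_real_power)
  have "norm (z + w - cnj (z + w) * (z * w)) \<le> norm z * \<bar>1 - (norm w)\<^sup>2\<bar> + norm w * \<bar>1 - (norm z)\<^sup>2\<bar>"
    unfolding eq by (rule order_trans[OF norm_triangle_ineq]) (simp only: norm_mult norm_of_real order_refl)
  also have "\<dots> = (norm z + norm w) * (1 - norm z * norm w)"
  proof -
    have "(norm w)\<^sup>2 \<le> 1" "(norm z)\<^sup>2 \<le> 1"
      using zw by (simp_all add: power_le_one)
    then have "\<bar>1 - (norm w)\<^sup>2\<bar> = 1 - (norm w)\<^sup>2" "\<bar>1 - (norm z)\<^sup>2\<bar> = 1 - (norm z)\<^sup>2"
      by simp_all
    then show ?thesis
      by (simp only:) (simp add: algebra_simps power2_eq_square)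
  qed
  finally show ?thesis .
qed

text \<open>
  This description of the symmetrised bidisc by a strict inequality between continuous functions
  makes it evident that the set is open. Both directions come from comparing
  \<open>(\<bar>z\<bar> + \<bar>w\<bar>) (1 - \<bar>z\<bar> \<bar>w\<bar>)\<close> with \<open>(1 + \<bar>z\<bar> \<bar>w\<bar>) (1 - \<bar>z\<bar> \<bar>w\<bar>)\<close>: the first factors differ by
  \<open>(1 - \<bar>z\<bar>) (1 - \<bar>w\<bar>)\<close>, which is positive for two roots in the disc and at most \<open>0\<close> if just one of them
  is outside.
\<close>

lemma sym_bidisc_iff:
  "q \<in> sym_bidisc \<longleftrightarrow> norm (q $ 1 - cnj (q $ 1) * q $ 2) < 1 - (norm (q $ 2))\<^sup>2"
proof -
  obtain z w where q: "q = symmetrization z w" and wz: "norm w \<le> norm z"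
    by (metis symmetrization_surj symmetrization_commute linorder_le_cases)
  let ?r = "norm z" and ?t = "norm w" and ?l = "norm (z + w - cnj (z + w) * (z * w))"
  have "?l < 1 - (norm (z * w))\<^sup>2 \<longleftrightarrow> ?r < 1"
  proof
    assume r: "?r < 1"
    then have t: "?t < 1"
      using wz by simp
    have rt: "0 < (1 - ?r) * (1 - ?t)" "?r * ?t < 1"
      using r t mult_strict_mono[of ?r 1 ?t 1] by auto
    have "?l \<le> (?r + ?t) * (1 - ?r * ?t)"
      using r t by (intro norm_symmetric_combination_le) auto
    also have "\<dots> < (1 + ?r * ?t) * (1 - ?r * ?t)"
      using rt by (intro mult_strict_right_mono) (simp_all add: algebra_simps)
    finally show "?l < 1 - (norm (z * w))\<^sup>2"
      by (simp add: norm_mult algebra_simps power2_eq_square)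
  next
    assume l: "?l < 1 - (norm (z * w))\<^sup>2"
    \<comment> \<open>The left-hand side is a norm, so the right-hand side is positive; hence \<open>z w\<close> is in the disc.\<close>
    have rt: "?r * ?t < 1"
    proof -
      have "(norm (z * w))\<^sup>2 < 1\<^sup>2"
        using l norm_ge_zero[of "z + w - cnj (z + w) * (z * w)"] unfolding one_power2 by linarith
      then have "norm (z * w) < 1"
        by (rule power2_less_imp_less) simp
      then show ?thesis
        by (simp add: norm_mult)
    qed
    show "?r < 1"
    proof (rule ccontr)
      assume r: "\<not> ?r < 1"
      then have t: "?t < 1"
        using rt mult_mono[of 1 ?r 1 ?t] by fastforce
      have eq: "z + w - cnj (z + w) * (z * w) =
          z * of_real (1 - (norm w)\<^sup>2) - w * of_real ((norm z)\<^sup>2 - 1)"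
        by (simp add: algebra_simps complex_norm_square flip: of_real_power)
      have "(1 + ?r * ?t) * (1 - ?r * ?t) \<le> (?r + ?t) * (1 - ?r * ?t)"
        using r t rt mult_nonneg_nonneg[of "?r - 1" "1 - ?t"]
        by (intro mult_right_mono) (simp_all add: algebra_simps)
      also have "\<dots> = ?r * (1 - ?t\<^sup>2) - ?t * (?r\<^sup>2 - 1)"
        by (simp add: algebra_simps power2_eq_square)
      also have "\<dots> = norm (z * of_real (1 - (norm w)\<^sup>2)) - norm (w * of_real ((norm z)\<^sup>2 - 1))"
      proof -
        have "?t\<^sup>2 \<le> 1" "1 \<le> ?r\<^sup>2"
          using r t by (simp_all add: power_le_one)
        then have "\<bar>1 - ?t\<^sup>2\<bar> = 1 - ?t\<^sup>2" "\<bar>?r\<^sup>2 - 1\<bar> = ?r\<^sup>2 - 1"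
          by simp_all
        then show ?thesis
          unfolding norm_mult norm_of_real by (simp only:)
      qed
      also have "\<dots> \<le> ?l"
        unfolding eq by (rule norm_triangle_ineq2)
      finally show False
        using l by (simp add: norm_mult algebra_simps power2_eq_square)
    qed
  qed
  then show ?thesis
    using wz by (auto simp: q symmetrization_mem_iff)
qed

lemma open_sym_bidisc: "open sym_bidisc"
proof -
  have "sym_bidisc = {q. norm (q $ 1 - cnj (q $ 1) * q $ 2) < 1 - (norm (q $ 2))\<^sup>2}"
    using sym_bidisc_iff by blast
  also have "open \<dots>"
    by (intro open_Collect_less continuous_intros)
  finally show ?thesis .
qed

lemma continuous_symmetrization: "continuous_on UNIV (\<lambda>(z, w). symmetrization z w)"
proof -
  have "symmetrization z w = (\<chi> i. if i = 1 then z + w else z * w)" for z w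
    by (simp add: vec2_eq_iff)
  moreover have "continuous_on UNIV
      (\<lambda>x. \<chi> i::2. if i = 1 then fst x + snd x else (fst x * snd x :: complex))"
  proof (rule continuous_on_vec_lambda)
    show "continuous_on UNIV (\<lambda>x. if i = 1 then fst x + snd x else fst x * snd x :: complex)" for i :: 2
      by (cases "i = 1") (auto intro!: continuous_intros)
  qed
  ultimately show ?thesis
    by (simp add: case_prod_unfold)
qed

lemma closure_sym_bidisc_cases:
  assumes "q \<in> closure sym_bidisc"
  obtains z w where "norm z \<le> 1" "norm w \<le> 1" "q = symmetrization z w"
proof -
  let ?K = "(\<lambda>(z, w). symmetrization z w) ` (cball 0 1 \<times> cball 0 1)"
  have "compact ?K"
    by (intro compact_continuous_image continuous_on_subset[OF continuous_symmetrization] compact_Times) auto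
  moreover have "sym_bidisc \<subseteq> ?K"
    by (fastforce simp: sym_bidisc_def)
  ultimately have "closure sym_bidisc \<subseteq> ?K"
    by (simp add: closure_minimal compact_imp_closed)
  then show ?thesis
    using assms that by auto
qed

text \<open>
  The quotient of the two sides is the modulus of the function \<open>(s - 2 p) / (2 - s)\<close>, which is
  therefore at most \<open>1\<close> wherever \<open>s \<noteq> 2\<close>. The bound without division remains meaningful at \<open>s = 2\<close>.
\<close>

lemma norm_magic_function_le:
  fixes z w :: complex
  assumes "norm z \<le> 1" "norm w \<le> 1"
  shows "norm (z + w - 2 * (z * w)) \<le> norm (2 - (z + w))"
proof -
  let ?s = "z + w" and ?p = "z * w" and ?r = "norm z" and ?t = "norm w"
  have rt: "0 \<le> (1 - ?r) * (1 - ?t)" "?r * ?t \<le> 1"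
    using assms by (auto intro: mult_le_one)
  have "Re (?s - cnj ?s * ?p) \<le> norm (?s - cnj ?s * ?p)"
    by (rule complex_Re_le_cmod)
  also have "\<dots> \<le> (?r + ?t) * (1 - ?r * ?t)"
    using assms by (rule norm_symmetric_combination_le)
  also have "\<dots> \<le> (1 + ?r * ?t) * (1 - ?r * ?t)"
    using rt by (intro mult_right_mono) (simp_all add: algebra_simps)
  also have "\<dots> = 1 - (norm ?p)\<^sup>2"
    by (simp add: norm_mult algebra_simps power2_eq_square)
  finally have le: "Re (?s - cnj ?s * ?p) \<le> 1 - (norm ?p)\<^sup>2" .
  have "(norm (2 - s))\<^sup>2 - (norm (s - 2 * p))\<^sup>2 = 4 * (1 - (norm p)\<^sup>2 - Re (s - cnj s * p))" for s p
    unfolding cmod_power2 by (simp add: power2_eq_square algebra_simps)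
  moreover have "X - Y = 4 * (1 - c - d) \<Longrightarrow> d \<le> 1 - c \<Longrightarrow> Y \<le> X" for X Y c d :: real
    by (simp add: algebra_simps)
  ultimately have "(norm (?s - 2 * ?p))\<^sup>2 \<le> (norm (2 - ?s))\<^sup>2"
    using le by blast
  then show ?thesis
    by (rule power2_le_imp_le) simp
qed

section \<open>Analytic maps between complex coordinate spaces\<close>

text \<open>
  On an open set the neighbourhood in the definition of analyticity can be discarded.
\<close>

lemma analytic_map_on_open:
  assumes "open S"
  shows "f analytic_map_on S \<longleftrightarrow>
    (\<forall>x\<in>S. \<exists>f'. (f has_derivative f') (at x) \<and> Vector_Spaces.linear (*s) (*s) f')"
    (is "_ \<longleftrightarrow> ?R")
proof
  show "f analytic_map_on S \<Longrightarrow> ?R"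
    unfolding analytic_map_on_def by (meson centre_in_ball)
  show "?R \<Longrightarrow> f analytic_map_on S"
    unfolding analytic_map_on_def using assms by (meson openE subsetD)
qed

text \<open>
  A derivative is real-linear already, so only complex homogeneity has to be checked.
\<close>

lemma complex_linear_derivativeI:
  fixes f :: "complex ^ 'n \<Rightarrow> complex ^ 'm"
  assumes "(f has_derivative f') F" "\<And>c v. f' (c *s v) = c *s f' v"
  shows "Vector_Spaces.linear (*s) (*s) f'"
proof -
  have "f' (u + v) = f' u + f' v" for u v
    using assms(1) by (simp add: has_derivative_linear linear_add)
  with assms(2) show ?thesis
    by (simp add: Vector_Spaces.linear_iff vec.vector_space_axioms)
qed

lemma has_derivative_vec_componentwise:
  fixes f :: "'a::real_normed_vector \<Rightarrow> 'b::euclidean_space ^ 'm"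
  shows "(f has_derivative f') (at x) \<longleftrightarrow>
    (\<forall>i. ((\<lambda>y. f y $ i) has_derivative (\<lambda>v. f' v $ i)) (at x))" (is "?L \<longleftrightarrow> ?R")
proof
  assume L: ?L
  show ?R
    using bounded_linear.has_derivative[OF bounded_linear_vec_nth L] by blast
next
  assume R: ?R
  show ?L
    unfolding has_derivative_componentwise_within[of f]
  proof
    fix b :: "'b ^ 'm" assume "b \<in> Basis"
    then obtain i u where "b = axis i u"
      by (auto simp: Basis_vec_def)
    then show "((\<lambda>y. f y \<bullet> b) has_derivative (\<lambda>v. f' v \<bullet> b)) (at x)"
      using R by (auto simp: inner_axis intro!: has_derivative_inner_left)
  qed
qed

lemma analytic_map_on_cong:
  assumes "open S" "f analytic_map_on S" "\<And>x. x \<in> S \<Longrightarrow> f x = g x"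
  shows "g analytic_map_on S"
proof -
  have "(g has_derivative f') (at x)" if "(f has_derivative f') (at x)" "x \<in> S" for f' x
    by (rule has_derivative_transform_within_open[OF that(1) assms(1) that(2)]) (rule assms(3))
  then show ?thesis
    using assms(1,2) by (meson analytic_map_on_open)
qed

lemma analytic_map_on_compose:
  assumes "open S" "f analytic_map_on S" "g analytic_map_on S" "f ` S \<subseteq> S"
  shows "(g \<circ> f) analytic_map_on S"
  unfolding analytic_map_on_open[OF assms(1)]
proof
  fix x assume x: "x \<in> S"
  obtain f' where f': "(f has_derivative f') (at x)" "Vector_Spaces.linear (*s) (*s) f'"
    using assms(1,2) x by (meson analytic_map_on_open)
  obtain g' where g': "(g has_derivative g') (at (f x))" "Vector_Spaces.linear (*s) (*s) g'"
    using assms x by (meson analytic_map_on_open image_subset_iff)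
  have d: "(g \<circ> f has_derivative g' \<circ> f') (at x)"
    using f'(1) g'(1) by (rule diff_chain_at)
  moreover have "Vector_Spaces.linear (*s) (*s) (g' \<circ> f')"
    using f'(2) g'(2) by (intro complex_linear_derivativeI[OF d]) (simp add: Vector_Spaces.linear_iff)
  ultimately show "\<exists>h'. (g \<circ> f has_derivative h') (at x) \<and> Vector_Spaces.linear (*s) (*s) h'"
    by blast
qed

lemma analytic_map_on_ident: "(\<lambda>x. x) analytic_map_on S"
  unfolding analytic_map_on_def
  by (auto intro!: exI[of _ 1] exI[of _ "\<lambda>x. x"] complex_linear_derivativeI[OF has_derivative_ident])

text \<open>
  The surjectivity proof restricts automorphisms to the one-variable curves \<open>t \<mapsto> (t + w, t w)\<close> and \<open>t \<mapsto> (2 t, t\<^sup>2)\<close>;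
  this is the chain rule for such restrictions.
\<close>

lemma field_differentiable_analytic_map_along_curve:
  assumes F: "F analytic_map_on S" "\<gamma> z \<in> S"
    and \<gamma>: "\<And>j. ((\<lambda>t. \<gamma> t $ j) has_field_derivative v $ j) (at z)"
  shows "(\<lambda>t. F (\<gamma> t) $ i) field_differentiable (at z)"
proof -
  obtain F' where F': "(F has_derivative F') (at (\<gamma> z))" "Vector_Spaces.linear (*s) (*s) F'"
    using F unfolding analytic_map_on_def by (meson centre_in_ball)
  have "(\<gamma> has_derivative (\<lambda>t. t *s v)) (at z)"
    unfolding has_derivative_vec_componentwise
  proof
    fix j
    have "(*) (v $ j) = (\<lambda>t. (t *s v) $ j)"
      by (simp add: fun_eq_iff)
    then show "((\<lambda>t. \<gamma> t $ j) has_derivative (\<lambda>t. (t *s v) $ j)) (at z)"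
      using \<gamma>[of j] by (simp only: has_field_derivative_def)
  qed
  from diff_chain_at[OF this F'(1)]
  have "((\<lambda>t. F (\<gamma> t) $ i) has_derivative (\<lambda>t. F' (t *s v) $ i)) (at z)"
    by (simp add: has_derivative_vec_componentwise o_def)
  moreover have "F' (t *s v) $ i = F' v $ i * t" for t
    using F'(2) by (simp add: Vector_Spaces.linear_iff mult.commute)
  ultimately show ?thesis
    by (auto simp: field_differentiable_def has_field_derivative_def)
qed

lemma analytic_map_on_quotients:
  fixes f :: "complex ^ 'n \<Rightarrow> complex ^ 'm"
  assumes "open S"
    and f: "\<And>x i. x \<in> S \<Longrightarrow> f x $ i = N i x / D i x" "\<And>x i. x \<in> S \<Longrightarrow> D i x \<noteq> 0"
    and N: "\<And>x i. (N i has_derivative N' i) (at x)" "\<And>i c v. N' i (c *s v) = c * N' i v"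
    and D: "\<And>x i. (D i has_derivative D' i) (at x)" "\<And>i c v. D' i (c *s v) = c * D' i v"
  shows "f analytic_map_on S"
proof -
  define g where "g x = (\<chi> i. N i x / D i x)" for x
  have "g analytic_map_on S"
    unfolding analytic_map_on_open[OF assms(1)]
  proof
    fix x assume x: "x \<in> S"
    define g' where "g' v = (\<chi> i. (N' i v * D i x - N i x * D' i v) / (D i x * D i x))" for v
    have d: "(g has_derivative g') (at x)"
      unfolding has_derivative_vec_componentwise g_def g'_def vec_lambda_beta
      using has_derivative_divide'[OF N(1) D(1) f(2)[OF x]] by blast
    moreover have "Vector_Spaces.linear (*s) (*s) g'"
      by (rule complex_linear_derivativeI[OF d])
        (simp add: g'_def vec_eq_iff N(2) D(2) algebra_simps diff_divide_distrib)
    ultimately show "\<exists>g'. (g has_derivative g') (at x) \<and> Vector_Spaces.linear (*s) (*s) g'"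
      by blast
  qed
  then show ?thesis
    by (rule analytic_map_on_cong[OF assms(1)]) (simp add: g_def vec_eq_iff f(1))
qed

section \<open>Automorphisms of the symmetrised bidisc induced from the disc\<close>

text \<open>
  The definite description is proper for an arbitrary function \<open>m\<close>, since exchanging the two
  points of the preimage does not change the symmetrization of their images.
\<close>

lemma tau_symmetrization:
  assumes "norm z < 1" "norm w < 1"
  shows "tau m (symmetrization z w) = symmetrization (m z) (m w)"
proof -
  have "(THE q. \<exists>z'\<in>disc. \<exists>w'\<in>disc. symmetrization z w = symmetrization z' w' \<and>
      q = symmetrization (m z') (m w')) = symmetrization (m z) (m w)"
  proof (rule the_equality)
    show "\<exists>z'\<in>disc. \<exists>w'\<in>disc. symmetrization z w = symmetrization z' w' \<and>
        symmetrization (m z) (m w) = symmetrization (m z') (m w')"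
      using assms by (intro bexI[of _ z] bexI[of _ w]) auto
  qed (auto simp: symmetrization_eq_iff doubleton_eq_iff)
  then show ?thesis
    using assms by (simp add: tau_def)
qed

lemma tau_mem:
  assumes "m \<in> disc \<rightarrow> disc" "q \<in> sym_bidisc"
  shows "tau m q \<in> sym_bidisc"
  using assms(2)
proof (rule sym_bidiscE)
  fix z w assume "norm z < 1" "norm w < 1" "q = symmetrization z w"
  then show ?thesis
    using assms(1) by (auto simp: tau_symmetrization Pi_iff)
qed

lemma tau_extensional: "tau m \<in> extensional sym_bidisc"
  by (simp add: tau_def)

lemma tau_compose:
  assumes "f \<in> disc \<rightarrow> disc"
  shows "tau (compose disc g f) = compose sym_bidisc (tau g) (tau f)"
proof (rule extensionalityI[OF tau_extensional compose_extensional])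
  fix q assume "q \<in> sym_bidisc"
  then show "tau (compose disc g f) q = compose sym_bidisc (tau g) (tau f) q"
    using assms by (elim sym_bidiscE) (simp add: tau_symmetrization compose_def Pi_iff)
qed

lemma tau_id: "tau (\<lambda>x\<in>disc. x) = (\<lambda>x\<in>sym_bidisc. x)"
proof (rule extensionalityI[OF tau_extensional restrict_extensional])
  fix q assume "q \<in> sym_bidisc"
  then show "tau (\<lambda>x\<in>disc. x) q = (\<lambda>x\<in>sym_bidisc. x) q"
    by (elim sym_bidiscE) (simp add: tau_symmetrization)
qed

text \<open>
  After composing with the Moebius map that moves \<open>0\<close> to the zero \<open>a = k 0\<close> of \<open>m\<close>, both the
  automorphism and its inverse fix \<open>0\<close>. The Schwarz lemma applied to the two of them shows that
  neither changes the modulus of a point, so the composite is a rotation.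
\<close>

lemma disc_automorphism_Moebius:
  assumes m: "m holomorphic_on disc" "\<And>z. z \<in> disc \<Longrightarrow> m z \<in> disc"
    and k: "k holomorphic_on disc" "\<And>z. z \<in> disc \<Longrightarrow> k z \<in> disc"
    and km: "\<And>z. z \<in> disc \<Longrightarrow> k (m z) = z" and mk: "\<And>z. z \<in> disc \<Longrightarrow> m (k z) = z"
  obtains c a where "norm a < 1" "\<And>z. z \<in> disc \<Longrightarrow> m z = c * (z - a) / (1 - cnj a * z)"
proof -
  define a where "a = k 0"
  have a: "norm a < 1"
    using k(2)[of 0] by (simp add: a_def)
  define \<phi> \<psi> where "\<phi> = Moebius_function 0 (-a)" and "\<psi> = Moebius_function 0 a"
  have hol: "\<phi> holomorphic_on disc" "\<psi> holomorphic_on disc"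
    using a by (auto simp: \<phi>_def \<psi>_def disc_eq_ball intro!: Moebius_function_holomorphic)
  have mem: "norm (\<phi> z) < 1" "norm (\<psi> z) < 1" if "norm z < 1" for z
    using a that by (auto simp: \<phi>_def \<psi>_def Moebius_function_norm_lt_1)
  have inv: "\<phi> (\<psi> z) = z" "\<psi> (\<phi> z) = z" if "norm z < 1" for z
    using a that by (auto simp: \<phi>_def \<psi>_def intro!: Moebius_function_compose)
  have at0: "\<phi> 0 = a" "\<psi> a = 0"
    by (simp_all add: \<phi>_def \<psi>_def Moebius_function_simple)
  have g: "m \<circ> \<phi> holomorphic_on ball 0 1" "(m \<circ> \<phi>) 0 = 0" "\<And>z. norm z < 1 \<Longrightarrow> norm ((m \<circ> \<phi>) z) < 1"
    using m hol(1) mem(1) mk[of 0] at0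
    by (auto simp: a_def simp flip: disc_eq_ball intro!: holomorphic_on_compose_gen[of \<phi> disc m disc])
  have h: "\<psi> \<circ> k holomorphic_on ball 0 1" "(\<psi> \<circ> k) 0 = 0" "\<And>z. norm z < 1 \<Longrightarrow> norm ((\<psi> \<circ> k) z) < 1"
    using k hol(2) mem(2) at0
    by (auto simp: a_def simp flip: disc_eq_ball intro!: holomorphic_on_compose_gen[of k disc \<psi> disc])
  let ?x = "1 / 2 :: complex"
  have x: "norm ?x < 1"
    by simp
  have gx: "norm ((m \<circ> \<phi>) ?x) < 1"
    using g(3) x by blast
  have hg: "(\<psi> \<circ> k) ((m \<circ> \<phi>) ?x) = ?x"
    using km[of "\<phi> ?x"] mem(1)[OF x] inv(2)[OF x] by simp
  have "norm ((m \<circ> \<phi>) ?x) = norm ?x"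
    using Schwarz_Lemma(1)[OF g x] Schwarz_Lemma(1)[OF h gx] unfolding hg by (rule antisym)
  then obtain c where c: "\<And>z. norm z < 1 \<Longrightarrow> (m \<circ> \<phi>) z = c * z"
    using Schwarz_Lemma(3)[OF g x] x by (metis divide_eq_0_iff zero_neq_numeral zero_neq_one)
  have "m z = c * (z - a) / (1 - cnj a * z)" if "z \<in> disc" for z
    using c[of "\<psi> z"] mem(2)[of z] inv(1)[of z] that by (simp add: \<psi>_def Moebius_function_simple)
  with a show ?thesis
    by (rule that)
qed

text \<open>
  Writing \<open>m z + m w\<close> and \<open>m z m w\<close> over the common denominator
  \<open>(1 - cnj a z) (1 - cnj a w) = 1 - cnj a s + (cnj a)\<^sup>2 p\<close> makes numerators and denominator affine
  functions of \<open>(s, p)\<close>, and the denominator has no zero in the symmetrised bidisc.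
\<close>

lemma tau_Moebius_analytic:
  assumes a: "norm a < 1" and m: "\<And>z. z \<in> disc \<Longrightarrow> m z = c * (z - a) / (1 - cnj a * z)"
  shows "tau m analytic_map_on sym_bidisc"
proof -
  define D where "D q = 1 - cnj a * q $ 1 + (cnj a)\<^sup>2 * q $ 2" for q :: "complex ^ 2"
  define N where "N i q = (if i = 1 then c * ((1 + a * cnj a) * q $ 1 - 2 * a - 2 * cnj a * q $ 2)
      else c\<^sup>2 * (q $ 2 - a * q $ 1 + a\<^sup>2))" for i :: 2 and q :: "complex ^ 2"
  define D' where "D' q = - (cnj a * q $ 1) + (cnj a)\<^sup>2 * q $ 2" for q :: "complex ^ 2"
  define N' where "N' i q = (if i = 1 then c * ((1 + a * cnj a) * q $ 1 - 2 * cnj a * q $ 2)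
      else c\<^sup>2 * (q $ 2 - a * q $ 1))" for i :: 2 and q :: "complex ^ 2"
  have nz: "1 - cnj a * z \<noteq> 0" if "norm z < 1" for z
  proof -
    have "norm (cnj a * z) < 1"
      using norm_mult_less[of "cnj a" 1 z 1] a that by simp
    then show ?thesis
      by auto
  qed
  have D_sym: "D (symmetrization z w) = (1 - cnj a * z) * (1 - cnj a * w)" for z w
    by (simp add: D_def algebra_simps power2_eq_square)
  have dnth: "((\<lambda>q. q $ i) has_derivative (\<lambda>v. v $ i)) (at q)" for i :: 2 and q :: "complex ^ 2"
    by (rule bounded_linear_imp_has_derivative) (rule bounded_linear_vec_nth)
  show ?thesis
  proof (rule analytic_map_on_quotients[where N = N and N' = N' and D = "\<lambda>_. D" and D' = "\<lambda>_. D'"])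
    show "open sym_bidisc"
      by (rule open_sym_bidisc)
    show "D q \<noteq> 0" if "q \<in> sym_bidisc" for q
      using that nz by (auto elim!: sym_bidiscE simp: D_sym)
    show "tau m q $ i = N i q / D q" if q: "q \<in> sym_bidisc" for q i
    proof -
      obtain z w where zw: "norm z < 1" "norm w < 1" "q = symmetrization z w"
        using q by (rule sym_bidiscE)
      have "i = 1 \<or> i = 2"
        using exhaust_2 by blast
      then show ?thesis
        using zw nz[OF zw(1)] nz[OF zw(2)]
        by (auto simp: zw tau_symmetrization D_sym m N_def divide_simps)
          (simp_all add: algebra_simps power2_eq_square)
    qed
    show "(N i has_derivative N' i) (at q)" for q i
      unfolding N_def N'_def
      by (cases "i = 1") (auto intro!: derivative_eq_intros dnth simp: fun_eq_iff)
    show "(D has_derivative D') (at q)" for q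
      unfolding D_def D'_def by (auto intro!: derivative_eq_intros dnth simp: fun_eq_iff)
  qed (auto simp: N'_def D'_def algebra_simps)
qed

section \<open>Boundary behaviour of automorphisms\<close>

lemma holomorphic_on_disc_norm_max_const:
  assumes "f holomorphic_on disc" "\<And>z. z \<in> disc \<Longrightarrow> norm (f z) \<le> norm (f w)" "w \<in> disc" "z \<in> disc"
  shows "f z = f w"
proof -
  have "f constant_on disc"
    using assms by (intro maximum_modulus_principle[of f disc disc w]) (auto simp: disc_eq_ball)
  then show ?thesis
    using assms by (auto simp: constant_on_def)
qed

text \<open>
  An analytic disc \<open>(S, P)\<close> in the boundary of the symmetrised bidisc lies in one of the sets
  \<open>{(\<zeta> + u, \<zeta> u)}\<close> with \<open>\<zeta>\<close> fixed. Let \<open>\<zeta>\<close> be a unimodular root over the point \<open>0\<close>; by a rotation it is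
  \<open>1\<close>. The function \<open>(s - 2 p) / (2 - s)\<close> is bounded by \<open>1\<close> on the disc and takes the value \<open>1\<close> at \<open>0\<close>, so
  it is constantly \<open>1\<close>, which says that \<open>1\<close> is a root everywhere. If the denominator has a zero
  then \<open>s\<close> attains its largest possible modulus \<open>2\<close> there, so \<open>s = 2\<close> and both roots are \<open>1\<close> throughout.
\<close>

lemma boundary_disc_common_root:
  assumes hol: "S holomorphic_on disc" "P holomorphic_on disc"
    and bd: "\<And>w. w \<in> disc \<Longrightarrow> \<exists>a b. norm a = 1 \<and> norm b \<le> 1 \<and> S w = a + b \<and> P w = a * b"
  shows "\<exists>\<zeta>. \<forall>w\<in>disc. \<zeta>\<^sup>2 - S w * \<zeta> + P w = 0"
proof -
  obtain \<zeta> b0 where \<zeta>: "norm \<zeta> = 1" "S 0 = \<zeta> + b0" "P 0 = \<zeta> * b0"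
    using bd[of 0] by auto
  have \<zeta>0: "\<zeta> \<noteq> 0"
    using \<zeta>(1) by auto
  define s p where "s w = S w / \<zeta>" and "p w = P w / \<zeta>\<^sup>2" for w
  have hol': "s holomorphic_on disc" "p holomorphic_on disc"
    using hol \<zeta>0 unfolding s_def p_def by (auto intro!: holomorphic_intros)
  have bd': "\<exists>a b. norm a = 1 \<and> norm b \<le> 1 \<and> s w = a + b \<and> p w = a * b" if w: "w \<in> disc" for w
  proof -
    obtain a b where "norm a = 1" "norm b \<le> 1" "S w = a + b" "P w = a * b"
      using bd[OF w] by blast
    then show ?thesis
      using \<zeta>(1) \<zeta>0
      by (intro exI[of _ "a / \<zeta>"] exI[of _ "b / \<zeta>"])
        (simp add: s_def p_def norm_divide add_divide_distrib power2_eq_square)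
  qed
  have "1 - s w + p w = 0" if w: "w \<in> disc" for w
  proof (cases "\<exists>w0\<in>disc. s w0 = 2")
    case True
    then obtain w0 where w0: "w0 \<in> disc" "s w0 = 2"
      by blast
    have "norm (s z) \<le> 2" if "z \<in> disc" for z
    proof -
      obtain a b where "norm a = 1" "norm b \<le> 1" "s z = a + b"
        using bd'[OF \<open>z \<in> disc\<close>] by blast
      then show ?thesis
        using norm_triangle_ineq[of a b] by simp
    qed
    then have sw: "s w = 2"
      using holomorphic_on_disc_norm_max_const[OF hol'(1) _ w0(1) w] w0(2) by simp
    obtain a b where ab: "norm a = 1" "norm b \<le> 1" "s w = a + b" "p w = a * b"
      using bd'[OF w] by blast
    have "Re a + Re b = 2" "Re a \<le> 1" "Re b \<le> 1"
      using ab sw complex_Re_le_cmod[of a] complex_Re_le_cmod[of b]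
      by (auto simp: complex_eq_iff)
    then have "Re a = 1" "Re b = 1"
      by auto
    moreover have "Im a = 0"
      using ab(1) \<open>Re a = 1\<close> by (simp add: cmod_def)
    ultimately have "a = 1" "b = 1"
      using ab(3) sw by (auto simp: complex_eq_iff)
    then show ?thesis
      using ab by simp
  next
    case False
    define \<Phi> where "\<Phi> z = (s z - 2 * p z) / (2 - s z)" for z
    have nz: "2 - s z \<noteq> 0" if "z \<in> disc" for z
      using False that by force
    have "\<Phi> holomorphic_on disc"
      unfolding \<Phi>_def using hol' nz by (auto intro!: holomorphic_intros)
    moreover have "s 0 = 1 + b0 / \<zeta>" "p 0 = b0 / \<zeta>"
      using \<zeta> \<zeta>0 by (simp_all add: s_def p_def add_divide_distrib power2_eq_square)
    then have \<Phi>0: "\<Phi> 0 = 1"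
      using nz[of 0] by (simp add: \<Phi>_def)
    moreover have "norm (\<Phi> z) \<le> 1" if "z \<in> disc" for z
    proof -
      obtain a b where "norm a = 1" "norm b \<le> 1" "s z = a + b" "p z = a * b"
        using bd'[OF \<open>z \<in> disc\<close>] by blast
      then have "norm (s z - 2 * p z) \<le> norm (2 - s z)"
        using norm_magic_function_le[of a b] by simp
      then show ?thesis
        using nz[OF that] by (simp add: \<Phi>_def norm_divide)
    qed
    ultimately have "\<Phi> w = 1"
      using holomorphic_on_disc_norm_max_const[of \<Phi> 0 w] w by simp
    then have "s w - 2 * p w = 2 - s w"
      using nz[OF w] by (simp add: \<Phi>_def)
    moreover have "1 - s w + p w = ((2 - s w) - (s w - 2 * p w)) / 2"
      by (simp add: field_simps)
    ultimately show ?thesis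
      by (simp only: diff_self) simp
  qed
  then have "\<zeta>\<^sup>2 - S w * \<zeta> + P w = 0" if "w \<in> disc" for w
    using that \<zeta>0 by (fastforce simp: s_def p_def field_simps power2_eq_square)
  then show ?thesis
    by blast
qed

text \<open>
  A self-map of the symmetrised bidisc with a continuous left inverse is proper: if the arguments tend to the boundary, no
  limit point of the values can lie inside, as the left inverse would carry it back to an
  interior limit of the arguments. The remaining points of the closure have a unimodular root.
\<close>

lemma limit_of_escaping_points:
  fixes \<zeta> :: "nat \<Rightarrow> complex"
  assumes F: "F ` sym_bidisc \<subseteq> sym_bidisc"
    and K: "continuous_on sym_bidisc K" "K ` sym_bidisc \<subseteq> sym_bidisc"
      "\<And>q. q \<in> sym_bidisc \<Longrightarrow> K (F q) = q"
    and \<zeta>: "\<And>n. norm (\<zeta> n) < 1" "(\<lambda>n. norm (\<zeta> n)) \<longlonglongrightarrow> 1" and w: "norm w < 1"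
    and lim: "(\<lambda>n. F (symmetrization (\<zeta> n) w)) \<longlonglongrightarrow> q"
  obtains a b where "norm a = 1" "norm b \<le> 1" "q = symmetrization a b"
proof -
  have mem: "F (symmetrization (\<zeta> n) w) \<in> sym_bidisc" for n
    using F \<zeta>(1) w by auto
  then have "q \<in> closure sym_bidisc"
    unfolding closure_sequential using lim
    by (intro exI[of _ "\<lambda>n. F (symmetrization (\<zeta> n) w)"]) simp
  then obtain a b where ab: "norm a \<le> 1" "norm b \<le> 1" "q = symmetrization a b"
    by (rule closure_sym_bidisc_cases)
  have "\<not> (norm a < 1 \<and> norm b < 1)"
  proof
    assume "norm a < 1 \<and> norm b < 1"
    then have q: "q \<in> sym_bidisc"
      by (simp add: ab(3))
    have "isCont K q"
      using K(1) q open_sym_bidisc continuous_on_eq_continuous_at by blast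
    then have "(\<lambda>n. K (F (symmetrization (\<zeta> n) w))) \<longlonglongrightarrow> K q"
      using lim isCont_tendsto_compose by blast
    then have lim': "(\<lambda>n. symmetrization (\<zeta> n) w) \<longlonglongrightarrow> K q"
      using K(3) \<zeta>(1) w by simp
    have "\<forall>n. \<zeta> n \<in> cball 0 1"
      using \<zeta>(1) by (simp add: less_imp_le)
    then obtain \<xi> r where r: "strict_mono r" "(\<zeta> \<circ> r) \<longlonglongrightarrow> \<xi>"
      using compact_cball[of "0::complex" 1] unfolding compact_def by metis
    have "(\<lambda>n. norm ((\<zeta> \<circ> r) n)) \<longlonglongrightarrow> norm \<xi>"
      using r(2) by (rule tendsto_norm)
    moreover have "(\<lambda>n. norm ((\<zeta> \<circ> r) n)) \<longlonglongrightarrow> 1"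
      using LIMSEQ_subseq_LIMSEQ[OF \<zeta>(2) r(1)] by (simp add: o_def)
    ultimately have \<xi>: "norm \<xi> = 1"
      by (rule LIMSEQ_unique)
    have "isCont (\<lambda>(z, w). symmetrization z w) (\<xi>, w)"
      using continuous_symmetrization continuous_on_eq_continuous_at by blast
    moreover have "(\<lambda>n. ((\<zeta> \<circ> r) n, w)) \<longlonglongrightarrow> (\<xi>, w)"
      using r(2) by (intro tendsto_intros)
    ultimately have "(\<lambda>n. symmetrization ((\<zeta> \<circ> r) n) w) \<longlonglongrightarrow> symmetrization \<xi> w"
      using isCont_tendsto_compose by fastforce
    moreover have "(\<lambda>n. symmetrization ((\<zeta> \<circ> r) n) w) \<longlonglongrightarrow> K q"
      using LIMSEQ_subseq_LIMSEQ[OF lim' r(1)] by (simp add: o_def)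
    ultimately have "symmetrization \<xi> w = K q"
      by (rule LIMSEQ_unique)
    then show False
      using K(2) q \<xi> by (metis image_subset_iff symmetrization_mem_iff less_irrefl)
  qed
  then have "norm a = 1 \<or> norm b = 1"
    using ab by linarith
  then show ?thesis
    using that ab symmetrization_commute by metis
qed

lemma analytic_map_on_imp_continuous_on:
  assumes "f analytic_map_on S"
  shows "continuous_on S f"
proof (rule continuous_at_imp_continuous_on, rule ballI)
  fix x assume "x \<in> S"
  then obtain f' where "(f has_derivative f') (at x)"
    using assms unfolding analytic_map_on_def by (meson centre_in_ball)
  then show "isCont f x"
    by (rule has_derivative_continuous)
qed

lemma holomorphic_on_slice:
  assumes "F analytic_map_on sym_bidisc" "norm w < 1"
  shows "(\<lambda>z. F (symmetrization z w) $ i) holomorphic_on disc"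
    "(\<lambda>z. F (symmetrization w z) $ i) holomorphic_on disc"
proof -
  have "(\<lambda>z. F (symmetrization z w) $ i) field_differentiable (at z)" if "z \<in> disc" for z
  proof (rule field_differentiable_analytic_map_along_curve[OF assms(1), where v = "vector [1, w]"])
    show "symmetrization z w \<in> sym_bidisc"
      using that assms(2) by simp
    show "((\<lambda>t. symmetrization t w $ j) has_field_derivative (vector [1, w] :: complex ^ 2) $ j) (at z)" for j
      using exhaust_2[of j] by (auto intro!: derivative_eq_intros)
  qed
  then show "(\<lambda>z. F (symmetrization z w) $ i) holomorphic_on disc"
    using holomorphic_on_def field_differentiable_at_within by blast
  then show "(\<lambda>z. F (symmetrization w z) $ i) holomorphic_on disc"
    by (simp add: symmetrization_commute)
qed

text \<open>
  The points \<open>(2 z, z\<^sup>2)\<close> form the branch locus of the symmetrization (the royal variety). An induced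
  map sends such a point to the one over \<open>m z\<close>, so this restriction will show that \<open>m\<close> is holomorphic.
\<close>

lemma holomorphic_on_royal:
  assumes "F analytic_map_on sym_bidisc"
  shows "(\<lambda>z. F (symmetrization z z) $ i) holomorphic_on disc"
proof -
  have "(\<lambda>z. F (symmetrization z z) $ i) field_differentiable (at z)" if "z \<in> disc" for z
  proof (rule field_differentiable_analytic_map_along_curve[OF assms(1), where v = "vector [2, 2 * z]"])
    show "symmetrization z z \<in> sym_bidisc"
      using that by simp
    show "((\<lambda>t. symmetrization t t $ j) has_field_derivative (vector [2, 2 * z] :: complex ^ 2) $ j) (at z)" for j
      using exhaust_2[of j] by (auto intro!: derivative_eq_intros)
  qed
  then show ?thesis
    using holomorphic_on_def field_differentiable_at_within by blast
qed

lemma sym_bidisc_bounds: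
  assumes "q \<in> sym_bidisc"
  shows "norm (q $ i) \<le> 2"
proof -
  obtain z w where zw: "norm z < 1" "norm w < 1" "q = symmetrization z w"
    using assms by (rule sym_bidiscE)
  have "norm (z + w) \<le> 2" "norm (z * w) \<le> 1"
    using zw norm_triangle_ineq[of z w] by (auto simp: norm_mult intro: mult_le_one)
  then show ?thesis
    using zw exhaust_2[of i] by auto
qed

lemma Montel_disc:
  fixes f :: "nat \<Rightarrow> complex \<Rightarrow> complex"
  assumes "\<And>n. f n holomorphic_on disc" "\<And>n z. z \<in> disc \<Longrightarrow> norm (f n z) \<le> B"
  obtains g r where "g holomorphic_on disc" "strict_mono (r :: nat \<Rightarrow> nat)"
    "\<And>z. z \<in> disc \<Longrightarrow> (\<lambda>n. f (r n) z) \<longlonglongrightarrow> g z"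
proof (rule Montel[of disc "{h. h holomorphic_on disc \<and> (\<forall>z\<in>disc. norm (h z) \<le> B)}" f])
  show "open disc"
    by (simp add: disc_eq_ball)
  show "\<exists>C. \<forall>h\<in>{h. h holomorphic_on disc \<and> (\<forall>z\<in>disc. norm (h z) \<le> B)}. \<forall>z\<in>K. norm (h z) \<le> C"
    if "K \<subseteq> disc" for K
    using that by blast
  show "range f \<subseteq> {h. h holomorphic_on disc \<and> (\<forall>z\<in>disc. norm (h z) \<le> B)}"
    using assms by auto
qed (use that in auto)

text \<open>
  This is the analytic heart of the proof, a Remmert--Stein argument. The resultant \<open>R z\<close> of the
  image points of \<open>(z, w1)\<close> and \<open>(z, w2)\<close> is holomorphic in \<open>z\<close>. If it were not zero at \<open>z0\<close>, the maximum
  principle would give points \<open>\<zeta> n\<close> tending to the circle with \<open>\<bar>R (\<zeta> n)\<bar> \<ge> \<bar>R z0\<bar>\<close>. By Montel's theorem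
  the maps \<open>w \<mapsto> F (\<zeta> n + w, \<zeta> n w)\<close> subconverge to an analytic disc, which lies in the boundary because
  \<open>F\<close> is proper. Its points have a common root, so the resultant of the limits at \<open>w1\<close> and \<open>w2\<close>
  vanishes: a contradiction.
\<close>

lemma analytic_proper_map_preserves_shared_root:
  assumes F: "F analytic_map_on sym_bidisc" "F ` sym_bidisc \<subseteq> sym_bidisc"
    and K: "continuous_on sym_bidisc K" "K ` sym_bidisc \<subseteq> sym_bidisc"
      "\<And>q. q \<in> sym_bidisc \<Longrightarrow> K (F q) = q"
    and z0: "norm z0 < 1" and w1: "norm w1 < 1" and w2: "norm w2 < 1"
  shows "roots (F (symmetrization z0 w1)) \<inter> roots (F (symmetrization z0 w2)) \<noteq> {}"
proof (rule ccontr)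
  define R where "R z = resultant (F (symmetrization z w1)) (F (symmetrization z w2))" for z
  assume "\<not> ?thesis"
  then have R0: "R z0 \<noteq> 0"
    by (simp add: R_def resultant_eq_0_iff)
  have holR: "R holomorphic_on disc"
    unfolding R_def resultant_def using w1 w2
    by (intro holomorphic_intros holomorphic_on_slice F)
  have "\<exists>z. norm z = r \<and> norm (R z0) \<le> norm (R z)" if r: "norm z0 < r" "r < 1" for r
  proof -
    have r0: "0 < r"
      using r norm_ge_zero[of z0] by linarith
    have sub: "cball 0 r \<subseteq> disc"
      using r by auto
    have cont: "continuous_on (cball 0 r) R"
      using holR sub holomorphic_on_imp_continuous_on continuous_on_subset by blast
    then have "continuous_on (sphere 0 r) (\<lambda>z. norm (R z))"
      by (intro continuous_on_norm) (auto intro: continuous_on_subset)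
    moreover have "sphere (0::complex) r \<noteq> {}"
      using r0 by simp
    ultimately obtain z where z: "z \<in> sphere 0 r" "\<forall>y\<in>sphere 0 r. norm (R y) \<le> norm (R z)"
      using continuous_attains_sup[OF compact_sphere] by metis
    have "norm (R z0) \<le> norm (R z)"
    proof (rule maximum_modulus_frontier[of R "cball 0 r"])
      show "R holomorphic_on interior (cball 0 r)"
        using holR sub interior_subset holomorphic_on_subset by blast
    qed (use cont z r r0 in auto)
    with z(1) show ?thesis
      by auto
  qed
  \<comment> \<open>Any sequence of radii in the interval from \<open>norm z0\<close> to \<open>1\<close> that tends to \<open>1\<close> serves.\<close>
  moreover define \<rho> where "\<rho> n = 1 - (1 - norm z0) / real (n + 2)" for n :: nat
  have \<rho>: "norm z0 < \<rho> n" "\<rho> n < 1" for n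
  proof -
    have "(1 - norm z0) * 1 < (1 - norm z0) * real (n + 2)"
      using z0 by (intro mult_strict_left_mono) auto
    then show "norm z0 < \<rho> n" "\<rho> n < 1"
      using z0 by (simp_all add: \<rho>_def field_simps)
  qed
  ultimately have "\<exists>z. norm z = \<rho> n \<and> norm (R z0) \<le> norm (R z)" for n
    by blast
  then obtain \<zeta> where \<zeta>: "\<And>n. norm (\<zeta> n) = \<rho> n" "\<And>n. norm (R z0) \<le> norm (R (\<zeta> n))"
    by metis
  have \<zeta>1: "norm (\<zeta> n) < 1" for n
    using \<zeta>(1) \<rho>(2) by simp
  have "(\<lambda>n. 1 - (1 - norm z0) * inverse (real (n + 2))) \<longlonglongrightarrow> 1 - (1 - norm z0) * 0"
    using LIMSEQ_ignore_initial_segment[OF lim_inverse_n, of 2] by (intro tendsto_intros) auto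
  then have lim\<rho>: "\<rho> \<longlonglongrightarrow> 1"
    by (simp add: \<rho>_def[abs_def] divide_inverse)
  define h where "h i n w = F (symmetrization (\<zeta> n) w) $ i" for i n w
  have hol: "h i n holomorphic_on disc" for i n
    unfolding h_def using holomorphic_on_slice(2)[OF F(1) \<zeta>1] .
  have bnd: "norm (h i n w) \<le> 2" if "w \<in> disc" for i n w
    unfolding h_def using F(2) \<zeta>1 that by (intro sym_bidisc_bounds) auto
  obtain S r where S: "S holomorphic_on disc" "strict_mono (r :: nat \<Rightarrow> nat)"
      "\<And>w. w \<in> disc \<Longrightarrow> (\<lambda>n. h 1 (r n) w) \<longlonglongrightarrow> S w"
    using Montel_disc[of "h 1" 2] hol bnd by blast
  obtain P t where P: "P holomorphic_on disc" "strict_mono (t :: nat \<Rightarrow> nat)"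
      "\<And>w. w \<in> disc \<Longrightarrow> (\<lambda>n. h 2 (r (t n)) w) \<longlonglongrightarrow> P w"
    using Montel_disc[of "\<lambda>n. h 2 (r n)" 2] hol bnd by blast
  define k where "k = r \<circ> t"
  have k: "strict_mono k"
    using S(2) P(2) by (simp add: k_def strict_mono_o)
  define L where "L w = (vector [S w, P w] :: complex ^ 2)" for w
  have lim: "(\<lambda>n. F (symmetrization (\<zeta> (k n)) w)) \<longlonglongrightarrow> L w" if w: "w \<in> disc" for w
  proof (rule vec_tendstoI)
    fix i :: 2
    have "(\<lambda>n. h 1 (r (t n)) w) \<longlonglongrightarrow> S w"
      using LIMSEQ_subseq_LIMSEQ[OF S(3)[OF w] P(2)] by (simp add: o_def)
    then show "(\<lambda>n. F (symmetrization (\<zeta> (k n)) w) $ i) \<longlonglongrightarrow> L w $ i"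
      using P(3)[OF w] exhaust_2[of i] by (auto simp: h_def k_def L_def)
  qed
  have lim1: "(\<lambda>n. norm (\<zeta> (k n))) \<longlonglongrightarrow> 1"
    using LIMSEQ_subseq_LIMSEQ[OF lim\<rho> k] by (simp add: \<zeta>(1) o_def)
  have "\<exists>a b. norm a = 1 \<and> norm b \<le> 1 \<and> S w = a + b \<and> P w = a * b" if w: "w \<in> disc" for w
  proof -
    obtain a b where "norm a = 1" "norm b \<le> 1" "L w = symmetrization a b"
      using limit_of_escaping_points[OF F(2) K \<zeta>1 lim1 _ lim[OF w]] w by auto
    then show ?thesis
      by (auto simp: L_def vec2_eq_iff)
  qed
  then obtain \<xi> where "\<forall>w\<in>disc. \<xi>\<^sup>2 - S w * \<xi> + P w = 0"
    using boundary_disc_common_root[OF S(1) P(1)] by blast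
  then have "\<xi> \<in> roots (L w1) \<inter> roots (L w2)"
    using w1 w2 by (simp add: roots_def L_def)
  then have "resultant (L w1) (L w2) = 0"
    using resultant_eq_0_iff by blast
  moreover have "(\<lambda>n. R (\<zeta> (k n))) \<longlonglongrightarrow> resultant (L w1) (L w2)"
    unfolding R_def resultant_def using w1 w2 by (intro tendsto_intros lim) auto
  ultimately have "(\<lambda>n. norm (R (\<zeta> (k n)))) \<longlonglongrightarrow> 0"
    by (simp add: tendsto_norm_zero)
  then have "norm (R z0) \<le> 0"
    using \<zeta>(2) by (intro LIMSEQ_le_const) auto
  with R0 show False
    by simp
qed

section \<open>The isomorphism of automorphism groups\<close>

lemma group_Aut_disc: "group Aut_disc"
  unfolding Aut_disc_def
proof (rule group_aut_group)
  have op: "open disc"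
    by (simp add: disc_eq_ball)
  show "g analytic_on disc" if "f analytic_on disc" "\<And>x. x \<in> disc \<Longrightarrow> f x = g x" for f g
    using that holomorphic_cong[of disc disc f g] by (simp add: analytic_on_open op)
  show "g \<circ> f analytic_on disc" if "f analytic_on disc" "g analytic_on disc" "f ` disc \<subseteq> disc" for f g
    using that holomorphic_on_compose_gen[of f disc g disc] by (simp add: analytic_on_open op)
  show "(\<lambda>x. x) analytic_on disc"
    by simp
qed

lemma group_Aut_sym_bidisc: "group Aut_sym_bidisc"
  unfolding Aut_sym_bidisc_def
proof (rule group_aut_group)
  show "g analytic_map_on sym_bidisc"
    if "f analytic_map_on sym_bidisc" "\<And>x. x \<in> sym_bidisc \<Longrightarrow> f x = g x" for f g
    using open_sym_bidisc that by (rule analytic_map_on_cong)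
  show "g \<circ> f analytic_map_on sym_bidisc"
    if "f analytic_map_on sym_bidisc" "g analytic_map_on sym_bidisc" "f ` sym_bidisc \<subseteq> sym_bidisc" for f g
    using open_sym_bidisc that by (rule analytic_map_on_compose)
qed (rule analytic_map_on_ident)

lemma Aut_discD:
  assumes "m \<in> carrier Aut_disc"
  defines "k \<equiv> restrict (inv_into disc m) disc"
  shows "m \<in> Bij disc" "k \<in> Bij disc" "m holomorphic_on disc" "k holomorphic_on disc"
    and "m \<in> disc \<rightarrow> disc" "k \<in> disc \<rightarrow> disc"
    and "compose disc k m = (\<lambda>x\<in>disc. x)" "compose disc m k = (\<lambda>x\<in>disc. x)"
    and "\<And>z. z \<in> disc \<Longrightarrow> k (m z) = z" "\<And>z. z \<in> disc \<Longrightarrow> m (k z) = z"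
proof -
  have op: "open disc"
    by (simp add: disc_eq_ball)
  show m: "m \<in> Bij disc"
    using assms by (simp add: Aut_disc_def aut_group_def)
  show k: "k \<in> Bij disc"
    unfolding k_def using m by (rule restrict_inv_into_Bij)
  show "m holomorphic_on disc" "k holomorphic_on disc"
    using assms holomorphic_cong[of disc disc k "inv_into disc m"]
    by (auto simp: Aut_disc_def aut_group_def analytic_on_open op k_def)
  show "m \<in> disc \<rightarrow> disc" "k \<in> disc \<rightarrow> disc"
    using m k by (simp_all add: Bij_imp_funcset del: mem_disc)
  have bij: "bij_betw m disc disc"
    using m by (simp add: Bij_def)
  show km: "k (m z) = z" if "z \<in> disc" for z
    using bij that bij_betwE[OF bij] by (simp add: k_def bij_betw_inv_into_left del: mem_disc)
  show mk: "m (k z) = z" if "z \<in> disc" for z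
    using bij that by (simp add: k_def bij_betw_inv_into_right del: mem_disc)
  show "compose disc k m = (\<lambda>x\<in>disc. x)" "compose disc m k = (\<lambda>x\<in>disc. x)"
    using km mk by (auto simp: compose_def fun_eq_iff)
qed

text \<open>
  Functoriality makes the map induced by the inverse of \<open>m\<close> the inverse of \<open>tau m\<close>, so the
  analyticity of both follows from the Moebius case.
\<close>

lemma tau_mem_Aut:
  assumes m: "m \<in> carrier Aut_disc"
  shows "tau m \<in> carrier Aut_sym_bidisc"
proof -
  define k where "k = restrict (inv_into disc m) disc"
  note mk = Aut_discD[OF m, folded k_def]
  have an: "tau m analytic_map_on sym_bidisc" "tau k analytic_map_on sym_bidisc"
  proof -
    obtain c a where "norm a < 1" "\<And>z. z \<in> disc \<Longrightarrow> m z = c * (z - a) / (1 - cnj a * z)"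
      using disc_automorphism_Moebius[OF mk(3) funcset_mem[OF mk(5)] mk(4) funcset_mem[OF mk(6)] mk(9,10)]
      by blast
    then show "tau m analytic_map_on sym_bidisc"
      by (rule tau_Moebius_analytic)
    obtain c a where "norm a < 1" "\<And>z. z \<in> disc \<Longrightarrow> k z = c * (z - a) / (1 - cnj a * z)"
      using disc_automorphism_Moebius[OF mk(4) funcset_mem[OF mk(6)] mk(3) funcset_mem[OF mk(5)] mk(10,9)]
      by blast
    then show "tau k analytic_map_on sym_bidisc"
      by (rule tau_Moebius_analytic)
  qed
  have left: "tau k (tau m q) = q" and right: "tau m (tau k q) = q" if "q \<in> sym_bidisc" for q
  proof -
    have "compose sym_bidisc (tau k) (tau m) q = q" "compose sym_bidisc (tau m) (tau k) q = q"
      using that by (simp_all only: tau_compose[OF mk(5), symmetric] tau_compose[OF mk(6), symmetric]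
          mk(7,8) tau_id restrict_apply')
    then show "tau k (tau m q) = q" "tau m (tau k q) = q"
      using that by (simp_all add: compose_eq)
  qed
  have bij: "bij_betw (tau m) sym_bidisc sym_bidisc"
    using left right tau_mem[OF mk(5)] tau_mem[OF mk(6)] by (intro bij_betwI[of _ _ _ "tau k"]) auto
  have "inv_into sym_bidisc (tau m) q = tau k q" if "q \<in> sym_bidisc" for q
    using bij right tau_mem[OF mk(6)] that by (intro inv_into_f_eq) (auto simp: bij_betw_def)
  then have "inv_into sym_bidisc (tau m) analytic_map_on sym_bidisc"
    using analytic_map_on_cong[OF open_sym_bidisc an(2)] by simp
  then show ?thesis
    using an(1) bij tau_extensional by (simp add: Aut_sym_bidisc_def aut_group_def Bij_def)
qed

lemma tau_hom: "tau \<in> hom Aut_disc Aut_sym_bidisc"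
proof (rule homI)
  fix g f assume gf: "g \<in> carrier Aut_disc" "f \<in> carrier Aut_disc"
  have "tau g \<in> Bij sym_bidisc" "tau f \<in> Bij sym_bidisc"
    using gf[THEN tau_mem_Aut] by (simp_all add: Aut_sym_bidisc_def aut_group_def)
  then show "tau (g \<otimes>\<^bsub>Aut_disc\<^esub> f) = tau g \<otimes>\<^bsub>Aut_sym_bidisc\<^esub> tau f"
    using tau_compose[OF Aut_discD(5)[OF gf(2)]] gf[THEN Aut_discD(1)]
    by (simp add: Aut_disc_def Aut_sym_bidisc_def aut_group_def BijGroup_def)
qed (rule tau_mem_Aut)

text \<open>
  The value of \<open>m\<close> at \<open>z\<close> can be recovered from the image of the point \<open>(2 z, z\<^sup>2)\<close>.
\<close>

lemma inj_on_tau: "inj_on tau (carrier Aut_disc)"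
proof (rule inj_onI)
  fix f g assume fg: "f \<in> carrier Aut_disc" "g \<in> carrier Aut_disc" and eq: "tau f = tau g"
  have "f z = g z" if "z \<in> disc" for z
  proof -
    have "symmetrization (f z) (f z) = symmetrization (g z) (g z)"
      using that tau_symmetrization[of z z f] tau_symmetrization[of z z g] eq by simp
    then show ?thesis
      by (simp add: symmetrization_eq_iff)
  qed
  then show "f = g"
    using fg[THEN Aut_discD(1), THEN Bij_imp_extensional] by (intro extensionalityI) auto
qed

text \<open>
  By the shared-root lemma, applied to \<open>F\<close> and to its inverse, the bijection of unordered pairs
  that corresponds to \<open>F\<close> preserves the relation of having a point in common. So it is induced by a
  bijection \<open>m\<close> of the disc, and \<open>m\<close> and its inverse are read off holomorphically from the first
  coordinate \<open>2 m z\<close> of \<open>F (2 z, z\<^sup>2)\<close> and its analogue for the inverse of \<open>F\<close>.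
\<close>

lemma Aut_sym_bidisc_induced:
  assumes F: "F \<in> carrier Aut_sym_bidisc"
  obtains m where "m \<in> carrier Aut_disc" "tau m = F"
proof -
  define K where "K = inv_into sym_bidisc F"
  have ext: "F \<in> extensional sym_bidisc" and bij: "bij_betw F sym_bidisc sym_bidisc"
    and an: "F analytic_map_on sym_bidisc" "K analytic_map_on sym_bidisc"
    using F by (auto simp: Aut_sym_bidisc_def aut_group_def Bij_def K_def)
  have bijK: "bij_betw K sym_bidisc sym_bidisc"
    unfolding K_def using bij by (rule bij_betw_inv_into)
  have img: "F ` sym_bidisc \<subseteq> sym_bidisc" "K ` sym_bidisc \<subseteq> sym_bidisc"
    using bij bijK by (auto simp: bij_betw_def)
  have KF: "K (F q) = q" and FK: "F (K q) = q" if "q \<in> sym_bidisc" for q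
    unfolding K_def
    using bij_betw_inv_into_left[OF bij that] bij_betw_inv_into_right[OF bij that] by auto
  have cont: "continuous_on sym_bidisc F" "continuous_on sym_bidisc K"
    using an by (auto intro: analytic_map_on_imp_continuous_on)
  let ?P = "{{a, b} |a b. a \<in> disc \<and> b \<in> disc}"
  define pt where "pt = inv_into sym_bidisc roots"
  have pt_roots: "pt (roots q) = q" if "q \<in> sym_bidisc" for q
    unfolding pt_def using bij_betw_inv_into_left[OF bij_betw_roots that] .
  have pt_pair: "pt {a, b} = symmetrization a b" if "a \<in> disc" "b \<in> disc" for a b
    using pt_roots[of "symmetrization a b"] that by simp
  have roots_pt: "roots (pt A) = A" "pt A \<in> sym_bidisc" if "A \<in> ?P" for A
    unfolding pt_def
    using bij_betw_inv_into_right[OF bij_betw_roots that]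
      bij_betwE[OF bij_betw_inv_into[OF bij_betw_roots]] that by blast+
  have roots_mem: "roots q \<in> ?P" if "q \<in> sym_bidisc" for q
    using bij_betwE[OF bij_betw_roots] that by blast
  have meet: "roots (H (pt A)) \<inter> roots (H (pt B)) \<noteq> {}"
    if H: "H analytic_map_on sym_bidisc" "H ` sym_bidisc \<subseteq> sym_bidisc"
      and L: "continuous_on sym_bidisc L" "L ` sym_bidisc \<subseteq> sym_bidisc"
      "\<And>q. q \<in> sym_bidisc \<Longrightarrow> L (H q) = q"
      and AB: "A \<in> ?P" "B \<in> ?P" "A \<inter> B \<noteq> {}" for H L A B
  proof -
    obtain z where z: "z \<in> A" "z \<in> B"
      using AB(3) by blast
    have second: "\<exists>v. X = {z, v} \<and> z \<in> disc \<and> v \<in> disc" if "X \<in> ?P" "z \<in> X" for X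
    proof -
      obtain a b where "X = {a, b}" "a \<in> disc" "b \<in> disc"
        using \<open>X \<in> ?P\<close> by blast
      with \<open>z \<in> X\<close> show ?thesis
        by (metis insertE insert_commute singletonD)
    qed
    obtain v w where v: "A = {z, v}" "z \<in> disc" "v \<in> disc" and w: "B = {z, w}" "w \<in> disc"
      using second[OF AB(1) z(1)] second[OF AB(2) z(2)] by blast
    show ?thesis
      using analytic_proper_map_preserves_shared_root[OF H L, of z v w] v w by (simp add: pt_pair)
  qed
  have "\<exists>m. bij_betw m disc disc \<and> (\<forall>z\<in>disc. \<forall>w\<in>disc. roots (F (pt {z, w})) = {m z, m w})"
  proof (rule pair_bijection_induced[where \<Psi> = "\<lambda>A. roots (K (pt A))"])
    show "infinite disc"
      using uncountable_ball[of 1 "0::complex"] countable_finite by (auto simp: disc_eq_ball)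
    show "roots (F (pt A)) \<in> ?P" "roots (K (pt A)) \<in> ?P" if "A \<in> ?P" for A
      using roots_mem img roots_pt(2)[OF that] by blast+
    show "roots (K (pt (roots (F (pt A))))) = A" "roots (F (pt (roots (K (pt A))))) = A"
      if "A \<in> ?P" for A
    proof -
      have "F (pt A) \<in> sym_bidisc" "K (pt A) \<in> sym_bidisc"
        using img roots_pt(2)[OF that] by blast+
      then show "roots (K (pt (roots (F (pt A))))) = A" "roots (F (pt (roots (K (pt A))))) = A"
        using roots_pt[OF that] KF FK by (simp_all add: pt_roots)
    qed
    show "roots (F (pt A)) \<inter> roots (F (pt B)) \<noteq> {}" if "A \<in> ?P" "B \<in> ?P" "A \<inter> B \<noteq> {}" for A B
      using meet[OF an(1) img(1) cont(2) img(2) KF that] .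
    show "roots (K (pt A)) \<inter> roots (K (pt B)) \<noteq> {}" if "A \<in> ?P" "B \<in> ?P" "A \<inter> B \<noteq> {}" for A B
      using meet[OF an(2) img(2) cont(1) img(1) FK that] .
  qed
  then obtain m where m: "bij_betw m disc disc"
      "\<And>z w. z \<in> disc \<Longrightarrow> w \<in> disc \<Longrightarrow> roots (F (symmetrization z w)) = {m z, m w}"
    using pt_pair by metis
  have F_eq: "F (symmetrization z w) = symmetrization (m z) (m w)" if "z \<in> disc" "w \<in> disc" for z w
    using m(2)[OF that] by (metis symmetrization_surj roots_symmetrization symmetrization_eq_iff)
  define k where "k = inv_into disc m"
  have k: "k z \<in> disc" "m (k z) = z" if "z \<in> disc" for z
    using bij_betw_inv_into_right[OF m(1) that] bij_betwE[OF bij_betw_inv_into[OF m(1)]] that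
    by (auto simp: k_def)
  have K_eq: "K (symmetrization z z) = symmetrization (k z) (k z)" if "z \<in> disc" for z
    using KF[of "symmetrization (k z) (k z)"] F_eq[of "k z" "k z"] k[OF that] by simp
  have hol: "restrict m disc holomorphic_on disc" "inv_into disc (restrict m disc) holomorphic_on disc"
  proof -
    have "(\<lambda>z. F (symmetrization z z) $ 1 / 2) holomorphic_on disc"
      by (intro holomorphic_intros holomorphic_on_royal an) simp
    then show "restrict m disc holomorphic_on disc"
      by (rule holomorphic_transform) (simp add: F_eq)
    have "(\<lambda>z. K (symmetrization z z) $ 1 / 2) holomorphic_on disc"
      by (intro holomorphic_intros holomorphic_on_royal an) simp
    moreover have "inv_into disc (restrict m disc) z = k z" if "z \<in> disc" for z
      using m(1) k[OF that] by (intro inv_into_f_eq) (auto simp: bij_betw_def inj_on_def)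
    ultimately show "inv_into disc (restrict m disc) holomorphic_on disc"
      by (elim holomorphic_transform) (simp add: K_eq)
  qed
  have "restrict m disc \<in> carrier Aut_disc"
    using hol m(1)
    by (simp add: Aut_disc_def aut_group_def Bij_def analytic_on_open disc_eq_ball)
  moreover have "tau (restrict m disc) = F"
  proof (rule extensionalityI[OF tau_extensional ext])
    fix q assume "q \<in> sym_bidisc"
    then show "tau (restrict m disc) q = F q"
      by (elim sym_bidiscE) (simp add: tau_symmetrization F_eq)
  qed
  ultimately show ?thesis
    by (rule that)
qed

theorem theorem4p1:
  "group Aut_disc \<and> group Aut_sym_bidisc \<and>
   (\<forall>m\<in>carrier Aut_disc. tau m \<in> carrier Aut_sym_bidisc \<and>
      (\<forall>z\<^sub>1\<in>disc. \<forall>z\<^sub>2\<in>disc.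
         tau m (symmetrization z\<^sub>1 z\<^sub>2) = symmetrization (m z\<^sub>1) (m z\<^sub>2))) \<and>
   tau \<in> iso Aut_disc Aut_sym_bidisc"
proof (intro conjI ballI)
  have "F \<in> tau ` carrier Aut_disc" if "F \<in> carrier Aut_sym_bidisc" for F
    using Aut_sym_bidisc_induced[OF that] by blast
  then have "tau ` carrier Aut_disc = carrier Aut_sym_bidisc"
    using tau_mem_Aut by blast
  then show "tau \<in> iso Aut_disc Aut_sym_bidisc"
    using tau_hom inj_on_tau by (simp add: iso_def bij_betw_def)
next
  fix m z\<^sub>1 z\<^sub>2 assume "z\<^sub>1 \<in> disc" "z\<^sub>2 \<in> disc"
  then show "tau m (symmetrization z\<^sub>1 z\<^sub>2) = symmetrization (m z\<^sub>1) (m z\<^sub>2)"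
    by (simp add: tau_symmetrization)
next
  show "group Aut_disc" "group Aut_sym_bidisc"
    by (rule group_Aut_disc group_Aut_sym_bidisc)+
next
  show "tau m \<in> carrier Aut_sym_bidisc" if "m \<in> carrier Aut_disc" for m
    using that by (rule tau_mem_Aut)
qed

end
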